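(* Let $R$ be a nonzero reduced commutative ring, let $n\ge 1$, and let $\varphi:A_n(R)\to A_n(R)$ be an automorphism of $R$-algebras. Then $\deg(\varphi^{-1})\le \deg(\varphi)^{2n-1}$.
   Context: For a commutative ring $R$, $A_n(R)$ is the $R$-algebra generated by $x_1,\dots,x_n,\partial_1,\dots,\partial_n$ with relations $[x_i,x_j]=0$, $[\partial_i,\partial_j]=0$, $[\partial_i,x_j]=\delta_{ij}$. It is a free $R$-module with basis the standard monomials $x^u\partial^v=x_1^{u_1}\cdots x_n^{u_n}\partial_1^{v_1}\cdots\partial_n^{v_n}$, $u,v\in\mathbb{N}^n$. For nonzero $f=\sum a_{uv}x^u\partial^v$, $\deg(f)=\max\{|u|+|v| : a_{uv}\neq0\}$, where $|w|=w_1+\dots+w_n$. For an endomorphism $\varphi$ of $A_n(R)$, $\deg(\varphi)=\max\{\deg\varphi(x_1),\dots,\deg\varphi(x_n),\deg\varphi(\partial_1),\dots,\deg\varphi(\partial_n)\}$. *)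

theory Defs
  imports Main
begin

text \<open>Weyl algebra A_n(R) as the free R-module on standard monomials x^u d^v,
  with multiplication given by the normal-ordering formula
  d^b x^c = sum_k C(b,k) C(c,k) k! x^(c-k) d^(b-k) (componentwise).\<close>

type_synonym mon = "(nat \<Rightarrow> nat) \<times> (nat \<Rightarrow> nat)"

definition wmons :: "nat \<Rightarrow> mon set" where
  "wmons n = {(u, v). \<forall>i\<ge>n. u i = 0 \<and> v i = 0}"

definition wsupp :: "(mon \<Rightarrow> 'a::zero) \<Rightarrow> mon set" where
  "wsupp f = {m. f m \<noteq> 0}"

definition weyl :: "nat \<Rightarrow> (mon \<Rightarrow> 'a::comm_ring_1) set" where
  "weyl n = {f. finite (wsupp f) \<and> wsupp f \<subseteq> wmons n}"

text \<open>Coefficient of x^e d^g in (x^a d^b)(x^c d^d); the shift k = a + c - e.\<close>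
definition wcoef :: "nat \<Rightarrow> mon \<Rightarrow> mon \<Rightarrow> mon \<Rightarrow> nat" where
  "wcoef n p q r = (case p of (a, b) \<Rightarrow> case q of (c, d) \<Rightarrow> case r of (e, g) \<Rightarrow>
     if r \<in> wmons n \<and> (\<forall>i<n. e i \<le> a i + c i \<and> a i + c i - e i \<le> b i
            \<and> a i + c i - e i \<le> c i \<and> g i + (a i + c i - e i) = b i + d i)
     then (\<Prod>i<n. (b i choose (a i + c i - e i)) * (c i choose (a i + c i - e i))
                    * fact (a i + c i - e i))
     else 0)"

definition wmul :: "nat \<Rightarrow> (mon \<Rightarrow> 'a::comm_ring_1) \<Rightarrow> (mon \<Rightarrow> 'a) \<Rightarrow> (mon \<Rightarrow> 'a)" where
  "wmul n f g = (\<lambda>r. \<Sum>p\<in>wsupp f. \<Sum>q\<in>wsupp g. f p * g q * of_nat (wcoef n p q r))"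

definition wone :: "mon \<Rightarrow> 'a::comm_ring_1" where
  "wone = (\<lambda>m. if m = (\<lambda>_. 0, \<lambda>_. 0) then 1 else 0)"

definition wX :: "nat \<Rightarrow> mon \<Rightarrow> 'a::comm_ring_1" where
  "wX i = (\<lambda>m. if m = ((\<lambda>_. 0)(i := 1), \<lambda>_. 0) then 1 else 0)"

definition wD :: "nat \<Rightarrow> mon \<Rightarrow> 'a::comm_ring_1" where
  "wD i = (\<lambda>m. if m = (\<lambda>_. 0, (\<lambda>_. 0)(i := 1)) then 1 else 0)"

definition tdeg :: "nat \<Rightarrow> mon \<Rightarrow> nat" where
  "tdeg n m = (\<Sum>i<n. fst m i) + (\<Sum>i<n. snd m i)"

definition wdeg :: "nat \<Rightarrow> (mon \<Rightarrow> 'a::comm_ring_1) \<Rightarrow> nat" where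
  "wdeg n f = Max (tdeg n ` wsupp f)"

definition weyl_alg_aut :: "nat \<Rightarrow> ((mon \<Rightarrow> 'a::comm_ring_1) \<Rightarrow> (mon \<Rightarrow> 'a)) \<Rightarrow> bool" where
  "weyl_alg_aut n \<phi> \<longleftrightarrow> bij_betw \<phi> (weyl n) (weyl n)
     \<and> (\<forall>f\<in>weyl n. \<forall>g\<in>weyl n. \<phi> (\<lambda>m. f m + g m) = (\<lambda>m. \<phi> f m + \<phi> g m))
     \<and> (\<forall>r. \<forall>f\<in>weyl n. \<phi> (\<lambda>m. r * f m) = (\<lambda>m. r * \<phi> f m))
     \<and> (\<forall>f\<in>weyl n. \<forall>g\<in>weyl n. \<phi> (wmul n f g) = wmul n (\<phi> f) (\<phi> g))
     \<and> \<phi> wone = wone"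

definition endo_deg :: "nat \<Rightarrow> ((mon \<Rightarrow> 'a::comm_ring_1) \<Rightarrow> (mon \<Rightarrow> 'a)) \<Rightarrow> nat" where
  "endo_deg n \<phi> = Max ((\<lambda>i. wdeg n (\<phi> (wX i))) ` {..<n} \<union> (\<lambda>i. wdeg n (\<phi> (wD i))) ` {..<n})"

definition reduced_ring :: "'a::comm_ring_1 itself \<Rightarrow> bool" where
  "reduced_ring _ \<longleftrightarrow> (\<forall>x::'a. \<forall>k::nat. x ^ k = 0 \<longrightarrow> x = 0)"

end

theory Submission
  imports Defs "HOL-Computational_Algebra.Polynomial"
begin

text \<open>
  Let \<open>g\<close> be the preimage of a generator \<open>x\<^sub>i\<close> under \<open>\<phi>\<close>, let \<open>e\<close> be its degree and \<open>d\<close> the degree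
  of \<open>\<phi>\<close>. Over a field, \<open>\<phi>\<close> embeds the part of \<open>A/gA\<close> of filtration degree at most \<open>m\<close> into the
  part of \<open>A/x\<^sub>iA\<close> of filtration degree at most \<open>dm\<close>. The dimensions grow like \<open>e m\<^sup>N/N!\<close> and
  \<open>(dm)\<^sup>N/N!\<close> with \<open>N = 2n - 1\<close>, hence \<open>e \<le> d\<^sup>N\<close>. For \<open>\<partial>\<^sub>i\<close> one uses left ideals instead.

  Over a reduced ring the comparison of dimensions becomes: if \<open>e > d\<^sup>N\<close>, then for large \<open>m\<close> there
  are more monomials of degree at most \<open>m\<close> not divisible by the leading monomial of \<open>g\<close> than
  monomials of degree at most \<open>dm\<close> free of \<open>x\<^sub>i\<close>. Gaussian elimination without division
  yields a combination \<open>f\<close> of the former with \<open>\<phi>(f) \<in> x\<^sub>iA\<close> and \<open>a f \<noteq> 0\<close>, where \<open>a\<close> is the leading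
  coefficient of \<open>g\<close>. Then \<open>f = g h\<close>, and comparing leading coefficients in \<open>a f = g (a h)\<close> gives
  \<open>a h = 0\<close> by reducedness, a contradiction.
\<close>

section \<open>Linear equations over a reduced ring\<close>

lemma reduced_ringD:
  fixes x :: "'a::comm_ring_1"
  assumes "reduced_ring TYPE('a)" and "x * x = 0"
  shows "x = 0"
  using assms unfolding reduced_ring_def by (metis power2_eq_square)

text \<open>Fraction-free Gaussian elimination, one row at a time. The factor \<open>a\<close>
  strengthens the induction: it absorbs the pivots, so that the solution of the smaller system stays
  nonzero after being scaled by them.\<close>

lemma reduced_underdetermined_system:
  fixes A :: "'b \<Rightarrow> 'c \<Rightarrow> 'a::comm_ring_1"
  assumes red: "reduced_ring TYPE('a)"
    and "finite T" and "finite S" and "card T < card S" and "a \<noteq> 0"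
  shows "\<exists>c. (\<forall>r\<in>T. (\<Sum>s\<in>S. A r s * c s) = 0) \<and> (\<exists>s\<in>S. a * c s \<noteq> 0)"
  using assms(2-)
proof (induction T arbitrary: A S a rule: finite_induct)
  case empty
  then obtain s where "s \<in> S" by fastforce
  with empty show ?case by (intro exI[of _ "\<lambda>_. 1"]) auto
next
  case (insert t T)
  show ?case
  \<comment> \<open>If \<open>a\<close> annihilates row \<open>t\<close>, a solution of the other
    rows multiplied by \<open>a\<close> also solves row \<open>t\<close>. Reducedness keeps it
    nonzero after a further factor \<open>a\<close>. Otherwise row \<open>t\<close> contains a pivot
    that \<open>a\<close> does not kill.\<close>
  proof (cases "\<forall>j\<in>S. a * A t j = 0")
    case True
    obtain c where c: "\<forall>r\<in>T. (\<Sum>s\<in>S. A r s * c s) = 0" "\<exists>s\<in>S. a * c s \<noteq> 0"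
      using insert.IH[of S a A] insert.prems insert.hyps by auto
    then obtain s where s: "s \<in> S" "a * c s \<noteq> 0" by blast
    have "a * (a * c s) \<noteq> 0"
    proof
      assume "a * (a * c s) = 0"
      then have "(a * c s) * (a * c s) = 0"
        by (metis mult.assoc mult.commute mult_zero_left)
      with s show False using reduced_ringD[OF red] by blast
    qed
    moreover have "(\<Sum>s\<in>S. A r s * (a * c s)) = 0" if "r \<in> insert t T" for r
    proof (cases "r = t")
      case r: True
      have "A t s * (a * c s) = 0" if "s \<in> S" for s
        using True that by (metis mult.assoc mult.commute mult_zero_left)
      then show ?thesis using r by simp
    next
      case False
      then have "(\<Sum>s\<in>S. A r s * c s) = 0" using c that by auto
      moreover have "(\<Sum>s\<in>S. A r s * (a * c s)) = a * (\<Sum>s\<in>S. A r s * c s)"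
        by (simp add: sum_distrib_left algebra_simps)
      ultimately show ?thesis by simp
    qed
    ultimately show ?thesis using s(1) by (intro exI[of _ "\<lambda>s. a * c s"]) blast
  next
    case False
    then obtain j where j: "j \<in> S" "a * A t j \<noteq> 0" by blast
    let ?S = "S - {j}"
    \<comment> \<open>Cross-multiplication with row \<open>t\<close> eliminates the unknown
      \<open>j\<close> without dividing by the pivot \<open>A t j\<close>.\<close>
    define B where "B r k = A t j * A r k - A r j * A t k" for r k
    have fS: "finite ?S" "card T < card ?S"
      using insert.prems insert.hyps j by auto
    obtain c where c: "\<forall>r\<in>T. (\<Sum>s\<in>?S. B r s * c s) = 0"
        "\<exists>s\<in>?S. a * A t j * c s \<noteq> 0"
      using insert.IH[OF fS j(2), of B] by blast
    \<comment> \<open>Back-substitution: scaling the other unknowns by the pivot lets row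
      \<open>t\<close> determine the value at \<open>j\<close> without division.\<close>
    define c' where "c' s = (if s = j then - (\<Sum>k\<in>?S. A t k * c k) else A t j * c s)" for s
    have split: "(\<Sum>s\<in>S. A r s * c' s)
        = A t j * (\<Sum>s\<in>?S. A r s * c s) - A r j * (\<Sum>s\<in>?S. A t s * c s)" for r
    proof -
      have "(\<Sum>s\<in>S. A r s * c' s) = A r j * c' j + (\<Sum>s\<in>?S. A r s * c' s)"
        using insert.prems(1) j by (simp add: sum.remove)
      also have "(\<Sum>s\<in>?S. A r s * c' s) = A t j * (\<Sum>s\<in>?S. A r s * c s)"
        unfolding sum_distrib_left by (rule sum.cong) (auto simp: c'_def algebra_simps)
      finally show ?thesis by (simp add: c'_def)
    qed
    have "(\<Sum>s\<in>S. A r s * c' s) = 0" if "r \<in> insert t T" for r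
    proof (cases "r = t")
      case True
      then show ?thesis using split by simp
    next
      case False
      then have "(\<Sum>s\<in>?S. B r s * c s) = 0" using c that by auto
      moreover have "(\<Sum>s\<in>?S. B r s * c s) = (\<Sum>s\<in>S. A r s * c' s)"
        unfolding split B_def
        by (simp add: sum_distrib_left sum_subtractf algebra_simps)
      ultimately show ?thesis by simp
    qed
    moreover have "\<exists>s\<in>S. a * c' s \<noteq> 0"
      using c(2) by (auto simp: c'_def mult.assoc)
    ultimately show ?thesis by blast
  qed
qed

section \<open>Counting exponents\<close>

definition bounded_exponents :: "'b set \<Rightarrow> nat \<Rightarrow> ('b \<Rightarrow> nat) set" where
  "bounded_exponents I k = {w. (\<forall>i. i \<notin> I \<longrightarrow> w i = 0) \<and> sum w I \<le> k}"

lemma bounded_exponents_insert: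
  assumes "finite I" and "i \<notin> I"
  shows "bounded_exponents (insert i I) k
    = (\<Union>j\<le>k. (\<lambda>w. w(i := j)) ` bounded_exponents I (k - j))" (is "?L = ?R")
proof
  show "?L \<subseteq> ?R"
  proof
    fix w assume w: "w \<in> ?L"
    have "sum (w(i := 0)) I = sum w I" using assms by (intro sum.cong) auto
    then have "w(i := 0) \<in> bounded_exponents I (k - w i)" "w i \<le> k"
      using w assms by (auto simp: bounded_exponents_def)
    moreover have "w = (w(i := 0))(i := w i)" by simp
    ultimately show "w \<in> ?R" by blast
  qed
  have "sum (w(i := j)) I = sum w I" for w :: "'a \<Rightarrow> nat" and j
    using assms by (intro sum.cong) auto
  then show "?R \<subseteq> ?L" using assms by (auto simp: bounded_exponents_def)
qed

text \<open>Stars and bars: giving the new coordinate the value \<open>j\<close> leaves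
  \<open>k - j\<close> for the others, and the hockey-stick identity adds up the counts.\<close>

lemma card_bounded_exponents:
  assumes "finite I"
  shows "finite (bounded_exponents I k) \<and>
    card (bounded_exponents I k) = (k + card I) choose (card I)"
  using assms
proof (induction I arbitrary: k rule: finite_induct)
  case empty
  have "bounded_exponents {} k = {\<lambda>_::'a. 0}" by (auto simp: bounded_exponents_def)
  then show ?case by simp
next
  case (insert i I)
  have inj: "inj_on (\<lambda>w. w(i := j)) (bounded_exponents I m)" for j m
  proof (rule inj_onI)
    fix w w' assume a: "w \<in> bounded_exponents I m" "w' \<in> bounded_exponents I m"
      and eq: "w(i := j) = w'(i := j)"
    have "w i = w' i" using a insert.hyps by (auto simp: bounded_exponents_def)
    with eq show "w = w'" by (metis fun_upd_triv fun_upd_upd)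
  qed
  have "card (bounded_exponents (insert i I) k)
      = (\<Sum>j\<le>k. card ((\<lambda>w. w(i := j)) ` bounded_exponents I (k - j)))"
    unfolding bounded_exponents_insert[OF insert.hyps]
  proof (rule card_UN_disjoint)
    show "\<forall>j\<in>{..k}. \<forall>j'\<in>{..k}. j \<noteq> j' \<longrightarrow>
        (\<lambda>w. w(i := j)) ` bounded_exponents I (k - j) \<inter>
        (\<lambda>w. w(i := j')) ` bounded_exponents I (k - j') = {}"
      by (auto dest: fun_upd_eqD)
  qed (use insert.IH in auto)
  also have "\<dots> = (\<Sum>j\<le>k. (k - j + card I) choose (card I))"
    using insert.IH by (simp add: card_image[OF inj])
  also have "\<dots> = (\<Sum>j\<le>k. (j + card I) choose (card I))"
    using sum.nat_diff_reindex[of "\<lambda>j. (j + card I) choose (card I)" "Suc k"]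
    by (simp add: lessThan_Suc_atMost)
  also have "\<dots> = (k + Suc (card I)) choose Suc (card I)"
    by (induction k) (auto simp: add.commute)
  finally show ?case
    using insert by (simp add: bounded_exponents_insert)
qed

text \<open>The right side is the product (x+1)(x+2)...(x+M), whose factors are all at least
  x+1.\<close>

lemma fact_times_binomial_ge: "(x + 1) ^ M \<le> fact M * ((x + M) choose M)"
proof (induction M)
  case (Suc M)
  have "Suc M * ((x + Suc M) choose Suc M) = (x + Suc M) * ((x + M) choose M)"
    using Suc_times_binomial[of M "x + M"] by simp
  then have "fact M * (Suc M * ((x + Suc M) choose Suc M))
      = (x + Suc M) * (fact M * ((x + M) choose M))"
    by (simp only: mult.left_commute)
  moreover have "fact (Suc M) = fact M * Suc M" by (simp only: fact_Suc of_nat_id mult.commute)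
  ultimately have "fact (Suc M) * ((x + Suc M) choose Suc M)
      = (x + Suc M) * (fact M * ((x + M) choose M))"
    by (simp only: mult.assoc)
  moreover have "(x + 1) * (x + 1) ^ M \<le> (x + Suc M) * (fact M * ((x + M) choose M))"
    using Suc by (intro mult_mono) auto
  ultimately show ?case by simp
qed simp

text \<open>By Pascal's rule each unit step in \<open>e\<close> adds a binomial coefficient no
  smaller than the first one added. This bounds from below the number of monomials not divisible by
  a given monomial of degree \<open>e\<close>.\<close>

lemma binomial_increment_ge:
  "((x + Suc M) choose Suc M) + e * ((x + Suc M) choose M) \<le> (x + e + Suc M) choose Suc M"
proof (induction e)
  case (Suc e)
  have "(x + Suc M) choose M \<le> (x + e + Suc M) choose M"
    by (rule binomial_right_mono) simp
  with Suc show ?case by simp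
qed simp

text \<open>As functions of \<open>x\<close> both sides grow like multiples of x^M / M!, with
  factors d^M and e, so the right side wins eventually.\<close>

lemma binomial_growth:
  fixes d e M :: nat
  assumes "d ^ M < e"
  shows "\<exists>x. (d * (x + e) + M) choose M < e * ((x + Suc M) choose M)"
proof -
  \<comment> \<open>Since (d(x+e)+M)/x tends to d, its M-th power is eventually below d^M + 1, which
    is at most e.\<close>
  have "(\<lambda>x::nat. (real d ^ M + 1) * 1 - (real d + (real d * real e + real M) / real x) ^ M)
      \<longlonglongrightarrow> (real d ^ M + 1) * 1 - (real d + 0) ^ M"
    by (intro tendsto_intros lim_const_over_n)
  then have "\<forall>\<^sub>F x::nat in sequentially.
      0 < (real d ^ M + 1) * 1 - (real d + (real d * real e + real M) / real x) ^ M"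
    by (intro order_tendstoD(1)) auto
  then obtain N where N: "\<And>x. x \<ge> N \<Longrightarrow>
      0 < (real d ^ M + 1) - (real d + (real d * real e + real M) / real x) ^ M"
    by (auto simp: eventually_sequentially)
  define x where "x = Suc N"
  have x: "real x > 0" by (simp add: x_def)
  have "(real d + (real d * real e + real M) / real x) ^ M * real x ^ M
      < (real d ^ M + 1) * real x ^ M"
    using N[of x] x by (intro mult_strict_right_mono) (auto simp: x_def)
  moreover have "(real d + (real d * real e + real M) / real x) ^ M * real x ^ M
      = real (d * (x + e) + M) ^ M"
    using x by (simp add: power_mult_distrib[symmetric] field_simps)
  ultimately have "real (d * (x + e) + M) ^ M < (real d ^ M + 1) * real x ^ M"
    by (simp only:)
  then have "real ((d * (x + e) + M) ^ M) < real ((d ^ M + 1) * x ^ M)"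
    by (simp only: of_nat_power of_nat_mult of_nat_add of_nat_1)
  then have less: "(d * (x + e) + M) ^ M < (d ^ M + 1) * x ^ M"
    by (simp only: of_nat_less_iff)
  have "fact M * ((d * (x + e) + M) choose M) \<le> (d * (x + e) + M) ^ M"
    using binomial_fact_pow by (metis mult.commute)
  also note less
  also have "(d ^ M + 1) * x ^ M \<le> e * (x + 1) ^ M"
    using assms by (intro mult_mono power_mono) auto
  also have "\<dots> \<le> e * (fact M * ((x + M) choose M))"
    using fact_times_binomial_ge by (intro mult_left_mono) auto
  also have "\<dots> \<le> e * (fact M * ((x + Suc M) choose M))"
    by (intro mult_left_mono binomial_right_mono) auto
  finally have "fact M * ((d * (x + e) + M) choose M) < fact M * (e * ((x + Suc M) choose M))"
    by (simp only: ac_simps)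
  then show ?thesis by (metis mult_less_cancel1)
qed

section \<open>Monomials\<close>

definition madd :: "mon \<Rightarrow> mon \<Rightarrow> mon" where
  "madd p q = (\<lambda>i. fst p i + fst q i, \<lambda>i. snd p i + snd q i)"

definition monomials_le :: "nat \<Rightarrow> nat \<Rightarrow> mon set" where
  "monomials_le n k = {p \<in> wmons n. tdeg n p \<le> k}"

lemma fst_madd [simp]: "fst (madd p q) i = fst p i + fst q i"
  and snd_madd [simp]: "snd (madd p q) i = snd p i + snd q i"
  by (simp_all add: madd_def)

lemma mon_eqI:
  fixes p q :: mon
  assumes "\<And>i. fst p i = fst q i" and "\<And>i. snd p i = snd q i"
  shows "p = q"
  using assms by (auto intro!: prod_eqI)

lemma in_wmons_iff: "p \<in> wmons n \<longleftrightarrow> (\<forall>i\<ge>n. fst p i = 0 \<and> snd p i = 0)"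
  by (auto simp: wmons_def)

lemma wmons_eqI:
  assumes "p \<in> wmons n" and "q \<in> wmons n"
    and "\<And>i. i < n \<Longrightarrow> fst p i = fst q i" and "\<And>i. i < n \<Longrightarrow> snd p i = snd q i"
  shows "p = q"
proof (rule mon_eqI)
  fix i
  have "i < n \<or> fst p i = 0 \<and> snd p i = 0 \<and> fst q i = 0 \<and> snd q i = 0"
    using assms(1,2) unfolding in_wmons_iff by (meson not_less)
  then show "fst p i = fst q i" and "snd p i = snd q i" using assms(3,4)[of i] by metis+
qed

lemma madd_commute: "madd p q = madd q p"
  by (intro mon_eqI) auto

lemma madd_in_wmons_iff: "madd p q \<in> wmons n \<longleftrightarrow> p \<in> wmons n \<and> q \<in> wmons n"
  by (auto simp: in_wmons_iff)

lemma inj_madd: "inj (madd p)"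
proof (rule injI)
  fix q q' assume "madd p q = madd p q'"
  then have "fst (madd p q) i = fst (madd p q') i" "snd (madd p q) i = snd (madd p q') i" for i
    by simp_all
  then show "q = q'" by (intro mon_eqI) auto
qed

lemma tdeg_madd: "tdeg n (madd p q) = tdeg n p + tdeg n q"
  by (simp add: tdeg_def sum.distrib)

text \<open>Joining both exponent vectors into one function on a disjoint sum turns monomials into
  \<open>bounded_exponents\<close>. \<open>I\<close> holds the variables allowed to occur: later all
  of them, or all but one.\<close>

lemma card_monomials_image:
  assumes "I \<subseteq> {..<n} <+> {..<n}"
  shows "card {p \<in> monomials_le n k. \<forall>i\<in>({..<n} <+> {..<n}) - I. case_sum (fst p) (snd p) i = 0}
    = (k + card I) choose (card I)"
    and "finite {p \<in> monomials_le n k. \<forall>i\<in>({..<n} <+> {..<n}) - I. case_sum (fst p) (snd p) i = 0}"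
proof -
  let ?N = "{..<n} <+> {..<n}"
  let ?P = "{p \<in> monomials_le n k. \<forall>i\<in>?N - I. case_sum (fst p) (snd p) i = 0}"
  let ?f = "\<lambda>p :: mon. case_sum (fst p) (snd p)"
  have fin: "finite I" using assms by (rule finite_subset) auto
  have inj: "inj_on ?f ?P"
  proof (rule inj_onI)
    fix p q :: mon assume "?f p = ?f q"
    then have "?f p (Inl i) = ?f q (Inl i)" "?f p (Inr i) = ?f q (Inr i)" for i
      by simp_all
    then show "p = q" by (intro mon_eqI) auto
  qed
  have tdeg: "tdeg n p = sum (?f p) ?N" for p
    by (simp add: tdeg_def sum.Plus)
  have sum_I: "sum w ?N = sum w I" if "\<forall>i\<in>?N - I. w i = 0" for w :: "nat + nat \<Rightarrow> nat"
    using assms that by (intro sum.mono_neutral_right) auto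
  have "?f ` ?P = bounded_exponents I k"
  proof
    show "?f ` ?P \<subseteq> bounded_exponents I k"
    proof
      fix w assume "w \<in> ?f ` ?P"
      then obtain p where p: "w = ?f p" "p \<in> ?P" by blast
      then have "sum w I \<le> k"
        using sum_I[of w] by (simp add: monomials_le_def tdeg)
      moreover have "w i = 0" if "i \<notin> I" for i
      proof (cases "i \<in> ?N")
        case True
        then show ?thesis using p that by auto
      next
        case False
        then show ?thesis
          using p by (cases i) (simp_all add: monomials_le_def in_wmons_iff Plus_def image_iff)
      qed
      ultimately show "w \<in> bounded_exponents I k" by (auto simp: bounded_exponents_def)
    qed
    show "bounded_exponents I k \<subseteq> ?f ` ?P"
    proof
      fix w assume w: "w \<in> bounded_exponents I k"
      let ?p = "(w \<circ> Inl, w \<circ> Inr)"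
      have wp: "?f ?p = w" by (auto simp: fun_eq_iff split: sum.split)
      have 0: "w i = 0" if "i \<notin> I" for i using w that by (auto simp: bounded_exponents_def)
      have "tdeg n ?p \<le> k"
        unfolding tdeg wp using sum_I[of w] 0 w by (simp add: bounded_exponents_def)
      moreover have "?p \<in> wmons n"
        using assms by (auto simp: in_wmons_iff intro!: 0)
      ultimately have "?p \<in> ?P" using 0 wp by (auto simp: monomials_le_def)
      then show "w \<in> ?f ` ?P" by (intro image_eqI[of _ _ ?p] wp[symmetric])
    qed
  qed
  note image = this
  have "card ?P = card (?f ` ?P)" by (rule card_image[OF inj, symmetric])
  then show "card ?P = (k + card I) choose (card I)"
    unfolding image using card_bounded_exponents[OF fin, of k] by argo
  have "finite (?f ` ?P)" unfolding image using card_bounded_exponents[OF fin, of k] by argo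
  then show "finite ?P" using inj by (rule finite_imageD)
qed

lemma card_monomials_le: "card (monomials_le n k) = (k + 2 * n) choose (2 * n)"
  and finite_monomials_le: "finite (monomials_le n k)"
  using card_monomials_image[of "{..<n} <+> {..<n}" n k] by (simp_all add: card_Plus mult_2)

lemma card_monomials_le_without:
  assumes "c \<in> {..<n} <+> {..<n}"
  shows "card {p \<in> monomials_le n k. case_sum (fst p) (snd p) c = 0}
    = (k + (2 * n - 1)) choose (2 * n - 1)"
proof -
  have "({..<n} <+> {..<n}) - (({..<n} <+> {..<n}) - {c}) = {c}" using assms by blast
  moreover have "card (({..<n} <+> {..<n}) - {c}) = 2 * n - 1"
    using assms by (simp add: card_Plus card_Diff_singleton)
  ultimately show ?thesis
    using card_monomials_image(1)[of "({..<n} <+> {..<n}) - {c}" n k] by simp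
qed

section \<open>A graded monomial order and leading monomials\<close>

text \<open>Polynomials over the integers are ordered by the sign of the leading coefficient, so this
  additive embedding realises a lexicographic order on monomials.\<close>

definition mkey :: "nat \<Rightarrow> mon \<Rightarrow> int poly" where
  "mkey n p = (\<Sum>i<n. monom (int (fst p i)) i) + (\<Sum>i<n. monom (int (snd p i)) (n + i))"

lemma mkey_madd: "mkey n (madd p q) = mkey n p + mkey n q"
  by (simp add: mkey_def sum.distrib add_monom[symmetric])

lemma coeff_mkey:
  assumes "j < n"
  shows "coeff (mkey n p) j = int (fst p j)" and "coeff (mkey n p) (n + j) = int (snd p j)"
  using assms by (simp_all add: mkey_def coeff_sum)

lemma inj_on_mkey: "inj_on (mkey n) (wmons n)"
proof (rule inj_onI)
  fix p q assume pq: "p \<in> wmons n" "q \<in> wmons n" "mkey n p = mkey n q"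
  show "p = q"
  proof (rule wmons_eqI[OF pq(1,2)])
    fix i assume "i < n"
    show "fst p i = fst q i" "snd p i = snd q i"
      using coeff_mkey[OF \<open>i < n\<close>] pq(3) by (metis of_nat_eq_iff)+
  qed
qed

text \<open>Total degree is compared first because normal ordering creates only correction terms of
  lower degree; \<open>mkey\<close> then breaks ties compatibly with multiplication of
  monomials.\<close>

definition leading_monomial :: "nat \<Rightarrow> (mon \<Rightarrow> 'a::comm_ring_1) \<Rightarrow> mon \<Rightarrow> bool" where
  "leading_monomial n f p \<longleftrightarrow> f p \<noteq> 0 \<and>
    (\<forall>q\<in>wsupp f. tdeg n q < tdeg n p \<or> tdeg n q = tdeg n p \<and> mkey n q \<le> mkey n p)"

lemma ex_leading_monomial:
  assumes "finite (wsupp f)" and "wsupp f \<noteq> {}"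
  shows "\<exists>p. leading_monomial n f p \<and> tdeg n p = wdeg n f"
proof -
  let ?D = "{p \<in> wsupp f. tdeg n p = wdeg n f}"
  have "wdeg n f \<in> tdeg n ` wsupp f" unfolding wdeg_def using assms by (intro Max_in) auto
  then have D: "?D \<noteq> {}" "finite ?D" using assms by (force, simp)
  then have "Max (mkey n ` ?D) \<in> mkey n ` ?D" by (intro Max_in) auto
  then obtain p where p: "p \<in> ?D" "mkey n p = Max (mkey n ` ?D)" by auto
  have "tdeg n q < tdeg n p \<or> tdeg n q = tdeg n p \<and> mkey n q \<le> mkey n p" if "q \<in> wsupp f" for q
  proof -
    have "tdeg n q \<le> tdeg n p" using p that assms by (simp add: wdeg_def)
    moreover have "mkey n q \<le> mkey n p" if "tdeg n q = tdeg n p"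
      unfolding p(2) using \<open>q \<in> wsupp f\<close> that p D by (intro Max_ge) auto
    ultimately show ?thesis by linarith
  qed
  with p(1) show ?thesis unfolding leading_monomial_def wsupp_def by blast
qed

section \<open>Multiplication in the Weyl algebra\<close>

definition wmono :: "mon \<Rightarrow> mon \<Rightarrow> 'a::comm_ring_1" where
  "wmono p = (\<lambda>m. if m = p then 1 else 0)"

text \<open>An upper bound that also makes sense for the zero element, for which \<open>wdeg\<close>
  would be the \<open>Max\<close> of an empty set.\<close>

definition deg_le :: "nat \<Rightarrow> nat \<Rightarrow> (mon \<Rightarrow> 'a::comm_ring_1) \<Rightarrow> bool" where
  "deg_le n k f \<longleftrightarrow> (\<forall>p. f p \<noteq> 0 \<longrightarrow> tdeg n p \<le> k)"

text \<open>\<open>k i\<close> counts the contractions of \<partial>_i from the left factor with x_i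
  from the right one; each contraction uses up one of both.\<close>

lemma wcoef_nonzero_exponents:
  fixes p q r :: mon
  defines "k \<equiv> \<lambda>i. fst p i + fst q i - fst r i"
  assumes "wcoef n p q r \<noteq> 0"
  shows "r \<in> wmons n"
    and "i < n \<Longrightarrow> fst r i + k i = fst p i + fst q i \<and> snd r i + k i = snd p i + snd q i
      \<and> k i \<le> snd p i \<and> k i \<le> fst q i"
proof -
  have "r \<in> wmons n \<and> (\<forall>i<n. fst r i \<le> fst p i + fst q i \<and> k i \<le> snd p i \<and> k i \<le> fst q i
      \<and> snd r i + k i = snd p i + snd q i)"
    using assms(2) unfolding wcoef_def k_def case_prod_beta by (metis (no_types, lifting) prod.collapse)
  then show "r \<in> wmons n"
    and "i < n \<Longrightarrow> fst r i + k i = fst p i + fst q i \<and> snd r i + k i = snd p i + snd q i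
      \<and> k i \<le> snd p i \<and> k i \<le> fst q i"
    by (simp, metis k_def le_add_diff_inverse)
qed

text \<open>Every contraction lowers the total degree by two, so only the term without contractions
  attains the full degree.\<close>

lemma wcoef_nonzeroD:
  assumes "wcoef n p q r \<noteq> 0"
  shows "r \<in> wmons n" and "tdeg n r \<le> tdeg n p + tdeg n q"
    and "p \<in> wmons n \<Longrightarrow> q \<in> wmons n \<Longrightarrow> tdeg n r = tdeg n p + tdeg n q \<Longrightarrow> r = madd p q"
proof -
  define k where "k i = fst p i + fst q i - fst r i" for i
  have r: "r \<in> wmons n" and k: "\<forall>i<n. fst r i + k i = fst p i + fst q i
      \<and> snd r i + k i = snd p i + snd q i"
    using wcoef_nonzero_exponents[OF assms] by (simp_all add: k_def)
  show "r \<in> wmons n" by (rule r)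
  have "(\<Sum>i<n. fst r i) + (\<Sum>i<n. k i) = (\<Sum>i<n. fst p i) + (\<Sum>i<n. fst q i)"
    "(\<Sum>i<n. snd r i) + (\<Sum>i<n. k i) = (\<Sum>i<n. snd p i) + (\<Sum>i<n. snd q i)"
    using k by (simp_all add: sum.distrib[symmetric])
  then have eq: "tdeg n r + 2 * (\<Sum>i<n. k i) = tdeg n p + tdeg n q" by (simp add: tdeg_def)
  then show "tdeg n r \<le> tdeg n p + tdeg n q" by simp
  assume pq: "p \<in> wmons n" "q \<in> wmons n" "tdeg n r = tdeg n p + tdeg n q"
  with eq have k0: "\<forall>i<n. k i = 0" by simp
  show "r = madd p q"
  proof (rule wmons_eqI[OF r])
    show "madd p q \<in> wmons n" using pq by (simp add: madd_in_wmons_iff)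
  qed (use k k0 in simp_all)
qed

lemma wcoef_madd:
  assumes "p \<in> wmons n" and "q \<in> wmons n"
  shows "wcoef n p q (madd p q) = 1"
proof -
  have "madd p q \<in> wmons n" using assms by (simp add: madd_in_wmons_iff)
  then show ?thesis by (cases p; cases q) (simp add: wcoef_def madd_def)
qed

text \<open>With no \<partial> on the left or no x on the right, the product is already in normal
  order.\<close>

lemma wcoef_unshifted:
  assumes "p \<in> wmons n" and "q \<in> wmons n" and "snd p = (\<lambda>_. 0) \<or> fst q = (\<lambda>_. 0)"
  shows "wcoef n p q r = (if r = madd p q then 1 else 0)"
proof -
  have "r = madd p q" if nz: "wcoef n p q r \<noteq> 0"
  proof (rule wmons_eqI[OF wcoef_nonzero_exponents(1)[OF nz]])
    show "madd p q \<in> wmons n" using assms by (simp add: madd_in_wmons_iff)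
    fix i assume "i < n"
    then show "fst r i = fst (madd p q) i" "snd r i = snd (madd p q) i"
      using wcoef_nonzero_exponents(2)[OF nz, of i] assms(3) by auto
  qed
  then show ?thesis using wcoef_madd[OF assms(1,2)] by metis
qed

text \<open>Allows summation over fixed index sets when a factor is rescaled, since zero divisors
  may shrink its support.\<close>

lemma wmul_eq_sum:
  assumes "finite P" and "finite Q" and "wsupp f \<subseteq> P" and "wsupp g \<subseteq> Q"
  shows "wmul n f g r = (\<Sum>p\<in>P. \<Sum>q\<in>Q. f p * g q * of_nat (wcoef n p q r))"
proof -
  have "wmul n f g r = (\<Sum>p\<in>wsupp f. \<Sum>q\<in>Q. f p * g q * of_nat (wcoef n p q r))"
    unfolding wmul_def using assms
    by (intro sum.cong sum.mono_neutral_left) (auto simp: wsupp_def)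
  also have "\<dots> = (\<Sum>p\<in>P. \<Sum>q\<in>Q. f p * g q * of_nat (wcoef n p q r))"
    using assms by (intro sum.mono_neutral_left) (auto simp: wsupp_def)
  finally show ?thesis .
qed

lemma wmul_nonzeroD:
  assumes "wmul n f g r \<noteq> 0"
  shows "\<exists>p\<in>wsupp f. \<exists>q\<in>wsupp g. wcoef n p q r \<noteq> 0"
proof (rule ccontr)
  assume "\<not> ?thesis"
  then have "wmul n f g r = 0" unfolding wmul_def by (intro sum.neutral ballI) auto
  with assms show False by simp
qed

lemma deg_le_wmul:
  assumes "deg_le n j f" and "deg_le n k g"
  shows "deg_le n (j + k) (wmul n f g)"
  unfolding deg_le_def
proof (intro allI impI)
  fix r assume "wmul n f g r \<noteq> 0"
  then obtain p q where "p \<in> wsupp f" "q \<in> wsupp g" "wcoef n p q r \<noteq> 0"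
    using wmul_nonzeroD by blast
  then have "tdeg n p \<le> j" "tdeg n q \<le> k" "tdeg n r \<le> tdeg n p + tdeg n q"
    using assms wcoef_nonzeroD(2) unfolding deg_le_def wsupp_def by blast+
  then show "tdeg n r \<le> j + k" by simp
qed

lemma deg_le_wdeg:
  assumes "f \<in> weyl n"
  shows "deg_le n (wdeg n f) f"
  using assms by (auto simp: deg_le_def wdeg_def weyl_def wsupp_def)

lemma deg_le_mono: "deg_le n j f \<Longrightarrow> j \<le> k \<Longrightarrow> deg_le n k f"
  unfolding deg_le_def using le_trans by blast

lemma wmul_in_weyl:
  assumes "f \<in> weyl n" and "g \<in> weyl n"
  shows "wmul n f g \<in> weyl n"
proof -
  have "deg_le n (wdeg n f + wdeg n g) (wmul n f g)"
    using assms by (intro deg_le_wmul deg_le_wdeg)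
  moreover have "wsupp (wmul n f g) \<subseteq> wmons n"
  proof
    fix r assume "r \<in> wsupp (wmul n f g)"
    then have "wmul n f g r \<noteq> 0" by (simp add: wsupp_def)
    then show "r \<in> wmons n" using wmul_nonzeroD wcoef_nonzeroD(1) by blast
  qed
  ultimately have "wsupp (wmul n f g) \<subseteq> monomials_le n (wdeg n f + wdeg n g)"
    by (auto simp: deg_le_def wsupp_def monomials_le_def)
  with \<open>wsupp (wmul n f g) \<subseteq> wmons n\<close> show ?thesis
    using finite_subset[OF _ finite_monomials_le] by (auto simp: weyl_def)
qed

text \<open>Only the pair of leading monomials contributes: degrees force both factors to be of top
  degree and exclude contractions, and the order settles the rest. The value may be 0 over a ring
  with zero divisors, so \<open>madd p q\<close> is not claimed to be leading.\<close>

lemma wmul_leading: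
  assumes "f \<in> weyl n" and "g \<in> weyl n" and "leading_monomial n f p" and "leading_monomial n g q"
  shows "wmul n f g (madd p q) = f p * g q"
proof -
  have pq: "p \<in> wsupp f" "q \<in> wsupp g" "finite (wsupp f)" "finite (wsupp g)"
    "p \<in> wmons n" "q \<in> wmons n"
    using assms unfolding leading_monomial_def weyl_def wsupp_def by blast+
  have uniq: "p' = p \<and> q' = q"
    if p': "p' \<in> wsupp f" and q': "q' \<in> wsupp g" and nz: "wcoef n p' q' (madd p q) \<noteq> 0"
    for p' q'
  proof -
    have w: "p' \<in> wmons n" "q' \<in> wmons n" using assms p' q' by (auto simp: weyl_def)
    have le: "tdeg n p' \<le> tdeg n p" "tdeg n q' \<le> tdeg n q"
      using assms(3,4) p' q' unfolding leading_monomial_def by (metis less_imp_le order_refl)+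
    moreover have "tdeg n p + tdeg n q \<le> tdeg n p' + tdeg n q'"
      using wcoef_nonzeroD(2)[OF nz] by (simp add: tdeg_madd)
    ultimately have eq: "tdeg n p' = tdeg n p" "tdeg n q' = tdeg n q" by simp_all
    then have "madd p q = madd p' q'"
      using wcoef_nonzeroD(3)[OF nz w] by (simp add: tdeg_madd)
    \<comment> \<open>Two equal sums whose summands satisfy termwise inequalities have equal
      summands.\<close>
    then have "mkey n p + mkey n q = mkey n p' + mkey n q'" by (metis mkey_madd)
    moreover have "mkey n p' \<le> mkey n p" "mkey n q' \<le> mkey n q"
      using assms(3,4) p' q' eq unfolding leading_monomial_def by (metis less_irrefl)+
    ultimately have "mkey n p' = mkey n p" "mkey n q' = mkey n q"
      by (metis add_le_less_mono add_less_le_mono less_irrefl order_le_less)+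
    then show ?thesis using inj_on_mkey w pq by (meson inj_onD)
  qed
  have "wmul n f g (madd p q)
      = (\<Sum>p'\<in>{p}. \<Sum>q'\<in>wsupp g. f p' * g q' * of_nat (wcoef n p' q' (madd p q)))"
    unfolding wmul_def using pq uniq
    by (intro sum.mono_neutral_right ballI sum.neutral) fastforce+
  also have "\<dots> = (\<Sum>q'\<in>wsupp g. f p * g q' * of_nat (wcoef n p q' (madd p q)))" by simp
  also have "\<dots> = (\<Sum>q'\<in>{q}. f p * g q' * of_nat (wcoef n p q' (madd p q)))"
    using pq uniq by (intro sum.mono_neutral_right) fastforce+
  also have "\<dots> = f p * g q" using pq by (simp add: wcoef_madd)
  finally show ?thesis .
qed

section \<open>Basis elements, module operations and exponent shifts\<close>

lemma wsupp_wmono: "wsupp (wmono p) \<subseteq> {p}"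
  by (auto simp: wsupp_def wmono_def)

lemma wmono_in_weyl: "p \<in> wmons n \<Longrightarrow> wmono p \<in> weyl n"
  using wsupp_wmono[of p] finite_subset by (fastforce simp: weyl_def)

lemma smult_in_weyl:
  assumes "f \<in> weyl n"
  shows "(\<lambda>m. c * f m) \<in> weyl n"
proof -
  have "wsupp (\<lambda>m. c * f m) \<subseteq> wsupp f" by (auto simp: wsupp_def)
  then show ?thesis using assms finite_subset by (fastforce simp: weyl_def)
qed

lemma add_in_weyl:
  assumes "f \<in> weyl n" and "g \<in> weyl n"
  shows "(\<lambda>m. f m + g m) \<in> weyl n"
proof -
  have "wsupp (\<lambda>m. f m + g m) \<subseteq> wsupp f \<union> wsupp g" by (auto simp: wsupp_def)
  moreover have "finite (wsupp f \<union> wsupp g)" "wsupp f \<union> wsupp g \<subseteq> wmons n"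
    using assms by (simp_all add: weyl_def)
  ultimately show ?thesis unfolding weyl_def by (blast intro: finite_subset)
qed

lemma zero_in_weyl: "(\<lambda>_. 0) \<in> weyl n"
  by (simp add: weyl_def wsupp_def)

lemma wmul_smult_right:
  assumes "f \<in> weyl n" and "g \<in> weyl n"
  shows "wmul n f (\<lambda>m. c * g m) = (\<lambda>m. c * wmul n f g m)"
proof
  fix r
  have "wmul n f (\<lambda>m. c * g m) r
      = (\<Sum>p\<in>wsupp f. \<Sum>q\<in>wsupp g. f p * (c * g q) * of_nat (wcoef n p q r))"
    using assms by (intro wmul_eq_sum) (auto simp: weyl_def wsupp_def)
  then show "wmul n f (\<lambda>m. c * g m) r = c * wmul n f g r"
    by (simp add: wmul_def sum_distrib_left algebra_simps)
qed

lemma wmul_smult_left: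
  assumes "f \<in> weyl n" and "g \<in> weyl n"
  shows "wmul n (\<lambda>m. c * f m) g = (\<lambda>m. c * wmul n f g m)"
proof
  fix r
  have "wmul n (\<lambda>m. c * f m) g r
      = (\<Sum>p\<in>wsupp f. \<Sum>q\<in>wsupp g. (c * f p) * g q * of_nat (wcoef n p q r))"
    using assms by (intro wmul_eq_sum) (auto simp: weyl_def wsupp_def)
  then show "wmul n (\<lambda>m. c * f m) g r = c * wmul n f g r"
    by (simp add: wmul_def sum_distrib_left algebra_simps)
qed

text \<open>Formal division by the monomial \<open>p\<close>: terms divisible by \<open>p\<close>
  lose that factor and the others are dropped. It supplies the cofactor in
  \<open>gen_mul_factor\<close>.\<close>

lemma shift_in_weyl:
  assumes "f \<in> weyl n"
  shows "(\<lambda>q. f (madd p q)) \<in> weyl n"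
proof -
  have "wsupp (\<lambda>q. f (madd p q)) = madd p -` wsupp f" by (auto simp: wsupp_def)
  moreover have "finite (madd p -` wsupp f)"
    using assms by (intro finite_vimageI inj_madd) (simp add: weyl_def)
  moreover have "madd p -` wsupp f \<subseteq> wmons n"
    using assms unfolding weyl_def by (blast dest: iffD1[OF madd_in_wmons_iff])
  ultimately show ?thesis by (simp add: weyl_def)
qed

lemma shift_wmono: "(\<lambda>q. wmono (madd p p') (madd p q)) = wmono p'"
  by (auto simp: wmono_def inj_eq[OF inj_madd])

section \<open>Automorphisms and generators\<close>

lemma aut_sum:
  assumes "weyl_alg_aut n \<phi>" and "finite S" and "S \<subseteq> wmons n"
  shows "(\<lambda>m. \<Sum>s\<in>S. c s * wmono s m) \<in> weyl n"
    and "\<phi> (\<lambda>m. \<Sum>s\<in>S. c s * wmono s m) = (\<lambda>m. \<Sum>s\<in>S. c s * \<phi> (wmono s) m)"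
proof -
  have add: "\<phi> (\<lambda>m. f m + g m) = (\<lambda>m. \<phi> f m + \<phi> g m)" if "f \<in> weyl n" "g \<in> weyl n" for f g
    using assms(1) that by (simp add: weyl_alg_aut_def)
  have scale: "\<phi> (\<lambda>m. r * f m) = (\<lambda>m. r * \<phi> f m)" if "f \<in> weyl n" for f r
    using assms(1) that by (simp add: weyl_alg_aut_def)
  have "(\<lambda>m. \<Sum>s\<in>S. c s * wmono s m) \<in> weyl n \<and>
    \<phi> (\<lambda>m. \<Sum>s\<in>S. c s * wmono s m) = (\<lambda>m. \<Sum>s\<in>S. c s * \<phi> (wmono s) m)"
    using assms(2,3)
  proof (induction S rule: finite_induct)
    case empty
    \<comment> \<open>Homogeneity with scalar 0 gives that \<phi> maps 0 to 0.\<close>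
    then show ?case using scale[OF zero_in_weyl, of 0] zero_in_weyl by simp
  next
    case (insert s S)
    have s: "wmono s \<in> weyl n" using insert.prems by (intro wmono_in_weyl) auto
    then have cs: "(\<lambda>m. c s * wmono s m) \<in> weyl n" by (rule smult_in_weyl)
    have IH: "(\<lambda>m. \<Sum>s\<in>S. c s * wmono s m) \<in> weyl n"
      "\<phi> (\<lambda>m. \<Sum>s\<in>S. c s * wmono s m) = (\<lambda>m. \<Sum>s\<in>S. c s * \<phi> (wmono s) m)"
      using insert by auto
    show ?case
      using insert.hyps add_in_weyl[OF cs IH(1)] add[OF cs IH(1)] scale[OF s] IH(2) by simp
  qed
  then show "(\<lambda>m. \<Sum>s\<in>S. c s * wmono s m) \<in> weyl n"
    "\<phi> (\<lambda>m. \<Sum>s\<in>S. c s * wmono s m) = (\<lambda>m. \<Sum>s\<in>S. c s * \<phi> (wmono s) m)"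
    by auto
qed

text \<open>A common type for x_i and \<partial>_i, so that the dimension argument is carried out
  only once.\<close>

datatype generator = GenX nat | GenD nat

definition generators :: "nat \<Rightarrow> generator set" where
  "generators n = GenX ` {..<n} \<union> GenD ` {..<n}"

fun gen_mon :: "generator \<Rightarrow> mon" where
  "gen_mon (GenX i) = ((\<lambda>_. 0)(i := 1), \<lambda>_. 0)"
| "gen_mon (GenD i) = (\<lambda>_. 0, (\<lambda>_. 0)(i := 1))"

fun gen_exp :: "generator \<Rightarrow> mon \<Rightarrow> nat" where
  "gen_exp (GenX i) p = fst p i"
| "gen_exp (GenD i) p = snd p i"

text \<open>In the normal ordering used here, the right ideal of \<open>x\<^sub>i\<close> and the left ideal of \<open>\<partial>\<^sub>i\<close> are
  spanned by monomials; \<open>gen_mul\<close> puts its first factor on the corresponding side.\<close>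

fun gen_mul :: "nat \<Rightarrow> generator \<Rightarrow> (mon \<Rightarrow> 'a::comm_ring_1) \<Rightarrow> (mon \<Rightarrow> 'a) \<Rightarrow> mon \<Rightarrow> 'a" where
  "gen_mul n (GenX i) f g = wmul n f g"
| "gen_mul n (GenD i) f g = wmul n g f"

lemma card_monomials_le_gen_free:
  assumes "c \<in> generators n"
  shows "card {p \<in> monomials_le n k. gen_exp c p = 0} = (k + (2 * n - 1)) choose (2 * n - 1)"
proof (cases c)
  case (GenX i)
  then show ?thesis
    using assms card_monomials_le_without[of "Inl i" n k] by (auto simp: generators_def)
next
  case (GenD i)
  then show ?thesis
    using assms card_monomials_le_without[of "Inr i" n k] by (auto simp: generators_def)
qed

lemma wX_eq_wmono: "wX i = wmono (gen_mon (GenX i))"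
  and wD_eq_wmono: "wD i = wmono (gen_mon (GenD i))"
  by (simp_all add: wX_def wD_def wmono_def)

lemma gen_mon_in_wmons: "c \<in> generators n \<Longrightarrow> gen_mon c \<in> wmons n"
  by (auto simp: generators_def in_wmons_iff)

lemma tdeg_gen_mon: "c \<in> generators n \<Longrightarrow> tdeg n (gen_mon c) = 1"
  by (auto simp: generators_def tdeg_def)

lemma gen_mon_divides:
  assumes "gen_exp c r \<noteq> 0"
  shows "\<exists>q. r = madd (gen_mon c) q"
proof (cases c)
  case (GenX i)
  then show ?thesis using assms
    by (intro exI[of _ "((fst r)(i := fst r i - 1), snd r)"] mon_eqI) simp_all
next
  case (GenD i)
  then show ?thesis using assms
    by (intro exI[of _ "(fst r, (snd r)(i := snd r i - 1))"] mon_eqI) simp_all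
qed

lemma gen_mul_in_weyl: "f \<in> weyl n \<Longrightarrow> g \<in> weyl n \<Longrightarrow> gen_mul n c f g \<in> weyl n"
  by (cases c) (simp_all add: wmul_in_weyl)

lemma deg_le_gen_mul:
  "deg_le n j f \<Longrightarrow> deg_le n k g \<Longrightarrow> deg_le n (j + k) (gen_mul n c f g)"
  using deg_le_wmul[of n j f k g] deg_le_wmul[of n k g j f]
  by (cases c) (simp_all add: add.commute)

lemma gen_mul_smult:
  "f \<in> weyl n \<Longrightarrow> g \<in> weyl n \<Longrightarrow> gen_mul n c f (\<lambda>m. r * g m) = (\<lambda>m. r * gen_mul n c f g m)"
  by (cases c) (simp_all add: wmul_smult_right wmul_smult_left)

lemma gen_mul_zero: "gen_mul n c f (\<lambda>_. 0) = (\<lambda>_. 0)"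
  by (cases c) (simp_all add: wmul_def wsupp_def)

lemma gen_mul_leading:
  assumes "f \<in> weyl n" and "g \<in> weyl n" and "leading_monomial n f p" and "leading_monomial n g q"
  shows "gen_mul n c f g (madd p q) = f p * g q"
proof (cases c)
  case (GenX i)
  then show ?thesis using wmul_leading[OF assms] by simp
next
  case (GenD i)
  then show ?thesis
    using wmul_leading[OF assms(2,1,4,3)] by (simp add: madd_commute[of p q] mult.commute)
qed

text \<open>On the side chosen by \<open>gen_mul\<close> no contraction occurs, so multiplying by a
  generator merely shifts exponents.\<close>

lemma gen_mul_wmono:
  assumes "c \<in> generators n" and "f \<in> weyl n"
  shows "gen_mul n c (wmono (gen_mon c)) f r
    = (\<Sum>q\<in>wsupp f. if r = madd (gen_mon c) q then f q else 0)"
proof -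
  let ?p = "gen_mon c"
  have f: "finite (wsupp f)" "wsupp f \<subseteq> wmons n" using assms(2) by (simp_all add: weyl_def)
  note p = gen_mon_in_wmons[OF assms(1)]
  show ?thesis
  proof (cases c)
    case (GenX i)
    have "wmul n (wmono ?p) f r
        = (\<Sum>p'\<in>{?p}. \<Sum>q\<in>wsupp f. wmono ?p p' * f q * of_nat (wcoef n p' q r))"
      using f by (intro wmul_eq_sum wsupp_wmono) simp_all
    also have "\<dots> = (\<Sum>q\<in>wsupp f. f q * of_nat (wcoef n ?p q r))" by (simp add: wmono_def)
    also have "\<dots> = (\<Sum>q\<in>wsupp f. if r = madd ?p q then f q else 0)"
    proof (rule sum.cong[OF refl])
      fix q assume "q \<in> wsupp f"
      then have "wcoef n ?p q r = (if r = madd ?p q then 1 else 0)"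
        using f(2) GenX by (intro wcoef_unshifted[OF p]) auto
      then show "f q * of_nat (wcoef n ?p q r) = (if r = madd ?p q then f q else 0)" by simp
    qed
    finally show ?thesis using GenX by simp
  next
    case (GenD i)
    have "wmul n f (wmono ?p) r
        = (\<Sum>q\<in>wsupp f. \<Sum>p'\<in>{?p}. f q * wmono ?p p' * of_nat (wcoef n q p' r))"
      using f by (intro wmul_eq_sum wsupp_wmono) simp_all
    also have "\<dots> = (\<Sum>q\<in>wsupp f. f q * of_nat (wcoef n q ?p r))" by (simp add: wmono_def)
    also have "\<dots> = (\<Sum>q\<in>wsupp f. if r = madd ?p q then f q else 0)"
    proof (rule sum.cong[OF refl])
      fix q assume "q \<in> wsupp f"
      then have "wcoef n q ?p r = (if r = madd q ?p then 1 else 0)"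
        using f(2) GenD by (intro wcoef_unshifted[OF _ p]) auto
      then show "f q * of_nat (wcoef n q ?p r) = (if r = madd ?p q then f q else 0)"
        by (simp add: madd_commute[of q])
    qed
    finally show ?thesis using GenD by simp
  qed
qed

text \<open>A membership test for the one-sided ideal of a generator: if every monomial of
  \<open>f\<close> contains the generator, it can be split off on the chosen side.\<close>

lemma gen_mul_factor:
  assumes c: "c \<in> generators n" and f: "f \<in> weyl n"
    and zero: "\<And>p. gen_exp c p = 0 \<Longrightarrow> f p = 0"
  shows "f = gen_mul n c (wmono (gen_mon c)) (\<lambda>q. f (madd (gen_mon c) q))"
proof
  fix r
  let ?p = "gen_mon c"
  let ?h = "\<lambda>q. f (madd ?p q)"
  have h: "?h \<in> weyl n" using f by (rule shift_in_weyl)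
  show "f r = gen_mul n c (wmono ?p) ?h r"
  proof (cases "\<exists>q. r = madd ?p q")
    case True
    then obtain q where q: "r = madd ?p q" by blast
    have "gen_mul n c (wmono ?p) ?h r = (\<Sum>q'\<in>wsupp ?h. if q = q' then ?h q' else 0)"
      unfolding gen_mul_wmono[OF c h] q inj_eq[OF inj_madd] ..
    also have "\<dots> = ?h q" using h by (simp add: weyl_def) (simp add: wsupp_def)
    finally show ?thesis using q by simp
  next
    case False
    then have "f r = 0" using gen_mon_divides zero by blast
    moreover have "gen_mul n c (wmono ?p) ?h r = 0"
      unfolding gen_mul_wmono[OF c h] using False by (intro sum.neutral ballI if_not_P) blast
    ultimately show ?thesis by simp
  qed
qed

section \<open>The degree bound\<close>

lemma aut_gen_mul:
  assumes "weyl_alg_aut n \<phi>" and "f \<in> weyl n" and "g \<in> weyl n"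
  shows "\<phi> (gen_mul n c f g) = gen_mul n c (\<phi> f) (\<phi> g)"
  using assms by (cases c) (simp_all add: weyl_alg_aut_def)

text \<open>Peel generators off a normally ordered monomial, x_i on the left and \<partial>_i on the
  right; the image of each adds at most \<open>d\<close> to the degree.\<close>

lemma aut_wmono_deg_le:
  fixes \<phi> :: "(mon \<Rightarrow> 'a::comm_ring_1) \<Rightarrow> (mon \<Rightarrow> 'a)"
  assumes aut: "weyl_alg_aut n \<phi>"
    and gen: "\<And>c. c \<in> generators n \<Longrightarrow> deg_le n d (\<phi> (wmono (gen_mon c)))"
    and "p \<in> wmons n"
  shows "deg_le n (d * tdeg n p) (\<phi> (wmono p))"
  using \<open>p \<in> wmons n\<close>
proof (induction "tdeg n p" arbitrary: p)
  case 0
  then have "p = (\<lambda>_. 0, \<lambda>_. 0)"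
    by (intro wmons_eqI[of _ n]) (simp_all add: tdeg_def in_wmons_iff)
  then have "wmono p = (wone :: mon \<Rightarrow> 'a)" by (simp add: wmono_def wone_def)
  then have "\<phi> (wmono p) = wone" using aut by (simp add: weyl_alg_aut_def)
  then show ?case by (auto simp: deg_le_def wone_def tdeg_def)
next
  case (Suc k)
  have "\<exists>c\<in>generators n. gen_exp c p \<noteq> 0"
  proof (rule ccontr)
    assume "\<not> ?thesis"
    then have zero: "gen_exp c p = 0" if "c \<in> generators n" for c
      using that by blast
    have "fst p i = 0" "snd p i = 0" if "i < n" for i
      using that zero[of "GenX i"] zero[of "GenD i"] by (simp_all add: generators_def)
    then have "tdeg n p = 0" by (simp add: tdeg_def)
    with Suc show False by simp
  qed
  then obtain c q where c: "c \<in> generators n" and pq: "p = madd (gen_mon c) q"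
    using gen_mon_divides by blast
  have q: "q \<in> wmons n" "tdeg n q = k"
    using Suc.hyps(2) Suc.prems unfolding pq
    by (simp_all add: madd_in_wmons_iff tdeg_madd tdeg_gen_mon[OF c])
  have zero: "wmono p r = (0 :: 'a)" if "gen_exp c r = 0" for r
  proof -
    have "gen_exp c p \<noteq> 0" unfolding pq by (cases c) simp_all
    then have "r \<noteq> p" using that by blast
    then show ?thesis by (simp add: wmono_def)
  qed
  have "wmono p = gen_mul n c (wmono (gen_mon c)) (wmono q :: mon \<Rightarrow> 'a)"
    using gen_mul_factor[OF c wmono_in_weyl[OF Suc.prems] zero] unfolding pq shift_wmono .
  then have "\<phi> (wmono p) = gen_mul n c (\<phi> (wmono (gen_mon c))) (\<phi> (wmono q))"
    using aut_gen_mul[OF aut wmono_in_weyl[OF gen_mon_in_wmons[OF c]] wmono_in_weyl[OF q(1)]]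
    by simp
  moreover have "deg_le n (d + d * k) (gen_mul n c (\<phi> (wmono (gen_mon c))) (\<phi> (wmono q)))"
    using Suc.hyps(1)[of q] q c by (intro deg_le_gen_mul gen) simp_all
  ultimately show ?case unfolding Suc.hyps(2)[symmetric] by simp
qed

lemma preimage_degree_bound:
  fixes \<phi> :: "(mon \<Rightarrow> 'a::comm_ring_1) \<Rightarrow> (mon \<Rightarrow> 'a)"
  assumes red: "reduced_ring TYPE('a)" and n: "n \<ge> 1" and aut: "weyl_alg_aut n \<phi>"
    and gen: "\<And>c. c \<in> generators n \<Longrightarrow> deg_le n d (\<phi> (wmono (gen_mon c)))"
    and c: "c \<in> generators n"
    and g: "g \<in> weyl n" "g \<noteq> (\<lambda>_. 0)" "\<phi> g = wmono (gen_mon c)"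
  shows "wdeg n g \<le> d ^ (2 * n - 1)"
proof (rule ccontr)
  assume large: "\<not> ?thesis"
  define M where "M = 2 * n - 1"
  define e where "e = wdeg n g"
  have N: "2 * n = Suc M" using n by (simp add: M_def)
  have "d ^ M < e" using large by (simp add: M_def e_def)
  \<comment> \<open>This \<open>x\<close> makes the unknowns in \<open>S\<close> outnumber the
    equations in \<open>T\<close> below, the degree bound on the domain side being
    \<open>x + e\<close>.\<close>
  then obtain x where x: "(d * (x + e) + M) choose M < e * ((x + Suc M) choose M)"
    using binomial_growth by blast
  have bij: "bij_betw \<phi> (weyl n) (weyl n)" using aut by (simp add: weyl_alg_aut_def)
  obtain m0 where m0: "leading_monomial n g m0" "tdeg n m0 = e"
    using ex_leading_monomial[of g n] g unfolding e_def weyl_def wsupp_def by fast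
  define a where "a = g m0"
  have a: "a \<noteq> 0" "m0 \<in> wmons n"
    using m0 g by (auto simp: leading_monomial_def a_def weyl_def wsupp_def)
  \<comment> \<open>Since \<open>m0\<close> has degree \<open>e\<close>, exactly the multiples of
    \<open>m0\<close> are removed. \<open>T\<close> indexes the coefficients of \<phi>(f) that must
    vanish for \<phi>(f) to lie in the ideal of the generator.\<close>
  define S where "S = monomials_le n (x + e) - madd m0 ` monomials_le n x"
  define T where "T = {p \<in> monomials_le n (d * (x + e)). gen_exp c p = 0}"
  have fin: "finite S" "finite T" by (simp_all add: S_def T_def finite_monomials_le)
  have "card T < card S"
  proof -
    have "card (madd m0 ` monomials_le n x) = (x + Suc M) choose Suc M"
      by (simp add: card_image inj_on_subset[OF inj_madd] card_monomials_le N)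
    then have "((x + e + Suc M) choose Suc M) - ((x + Suc M) choose Suc M) \<le> card S"
      unfolding S_def
      using diff_card_le_card_Diff[of "madd m0 ` monomials_le n x" "monomials_le n (x + e)"]
      by (simp add: finite_monomials_le card_monomials_le N)
    then have "e * ((x + Suc M) choose M) \<le> card S"
      using binomial_increment_ge[of x M e] by linarith
    moreover have "card T = (d * (x + e) + M) choose M"
      unfolding T_def card_monomials_le_gen_free[OF c] M_def ..
    ultimately show ?thesis using x by simp
  qed
  then obtain w s where w: "\<And>r. r \<in> T \<Longrightarrow> (\<Sum>s\<in>S. \<phi> (wmono s) r * w s) = 0"
      and s: "s \<in> S" "a * w s \<noteq> 0"
    using reduced_underdetermined_system[OF red fin(2,1) _ a(1), of "\<lambda>r s. \<phi> (wmono s) r"]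
    by blast
  have S: "S \<subseteq> wmons n" by (auto simp: S_def monomials_le_def)
  define f where "f = (\<lambda>m. \<Sum>s\<in>S. w s * wmono s m)"
  have f: "f \<in> weyl n" "\<phi> f = (\<lambda>m. \<Sum>s\<in>S. w s * \<phi> (wmono s) m)"
    unfolding f_def using aut_sum[OF aut fin(1) S] by auto
  have f_eq: "f m = (if m \<in> S then w m else 0)" for m
  proof -
    have "f m = (\<Sum>s\<in>S. if m = s then w s else 0)"
      unfolding f_def by (intro sum.cong) (auto simp: wmono_def)
    then show ?thesis using fin by simp
  qed
  have \<phi>f: "\<phi> f \<in> weyl n" using bij f(1) by (auto simp: bij_betw_def)
  \<comment> \<open>On \<open>T\<close> this is the linear system; the remaining monomials free of
    the generator have degree too large to occur in \<phi>(f).\<close>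
  have "\<phi> f p = 0" if p: "gen_exp c p = 0" for p
  proof (cases "p \<in> T")
    case True
    then show ?thesis using w[OF True] f by (simp add: mult.commute)
  next
    case False
    show ?thesis
    proof (cases "p \<in> wmons n")
      case True
      then have "d * (x + e) < tdeg n p"
        using False p by (auto simp: T_def monomials_le_def)
      have "\<phi> (wmono s) p = 0" if "s \<in> S" for s
      proof (rule ccontr)
        assume "\<phi> (wmono s) p \<noteq> 0"
        then have "tdeg n p \<le> d * tdeg n s"
          using aut_wmono_deg_le[OF aut gen, of s] S that unfolding deg_le_def by blast
        also have "\<dots> \<le> d * (x + e)" using that by (auto simp: S_def monomials_le_def)
        finally show False using \<open>d * (x + e) < tdeg n p\<close> by simp
      qed
      then show ?thesis using f by simp
    next
      case False
      then show ?thesis using \<phi>f by (auto simp: weyl_def wsupp_def)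
    qed
  qed
  then have "\<phi> f = gen_mul n c (\<phi> g) (\<lambda>q. \<phi> f (madd (gen_mon c) q))"
    unfolding g(3) by (rule gen_mul_factor[OF c \<phi>f])
  \<comment> \<open>Surjectivity of \<phi> pulls the cofactor back to \<open>h\<close>; injectivity
    then turns the factorization of \<phi>(f) into one of \<open>f\<close>.\<close>
  moreover obtain h where h: "h \<in> weyl n" "(\<lambda>q. \<phi> f (madd (gen_mon c) q)) = \<phi> h"
    using bij shift_in_weyl[OF \<phi>f, of "gen_mon c"] by (auto simp: bij_betw_def)
  ultimately have "\<phi> f = \<phi> (gen_mul n c g h)" using aut_gen_mul[OF aut g(1) h(1)] by metis
  then have fgh: "f = gen_mul n c g h"
    using bij f(1) gen_mul_in_weyl[OF g(1) h(1)] by (metis bij_betw_def inj_onD)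
  \<comment> \<open>All coefficients of \<open>h'\<close> are multiples of \<open>a\<close>, so one
    that is annihilated by \<open>a\<close> has square zero and vanishes.\<close>
  define h' where "h' = (\<lambda>m. a * h m)"
  have h': "h' \<in> weyl n" unfolding h'_def using h by (intro smult_in_weyl)
  have af: "gen_mul n c g h' = (\<lambda>m. a * f m)"
    unfolding h'_def fgh by (rule gen_mul_smult[OF g(1) h(1)])
  have "wsupp h' = {}"
  proof (rule ccontr)
    assume "wsupp h' \<noteq> {}"
    then obtain \<mu> where \<mu>: "leading_monomial n h' \<mu>"
      using ex_leading_monomial[of h' n] h' by (auto simp: weyl_def)
    then have "\<mu> \<in> wmons n" using h' by (auto simp: leading_monomial_def weyl_def wsupp_def)
    have "gen_mul n c g h' (madd m0 \<mu>) = a * h' \<mu>"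
      unfolding a_def by (rule gen_mul_leading[OF g(1) h' m0(1) \<mu>])
    \<comment> \<open>\<open>S\<close> contains no multiple of \<open>m0\<close>, so
      \<open>f\<close> has coefficient 0 there.\<close>
    moreover have "madd m0 \<mu> \<notin> S"
      using \<open>\<mu> \<in> wmons n\<close> m0 by (auto simp: S_def monomials_le_def tdeg_madd)
    ultimately have "a * h' \<mu> = 0" using af f_eq by simp
    then have "h' \<mu> * h' \<mu> = 0" by (metis h'_def mult.assoc mult.commute mult_zero_left)
    then have "h' \<mu> = 0" using reduced_ringD[OF red] by blast
    with \<mu> show False by (simp add: leading_monomial_def)
  qed
  then have "h' = (\<lambda>_. 0)" by (auto simp: wsupp_def)
  then have "gen_mul n c g h' = (\<lambda>_. 0)" by (simp add: gen_mul_zero)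
  \<comment> \<open>This contradicts the choice of \<open>s\<close>, for which
    \<open>a * w s\<close> is nonzero.\<close>
  then have "a * f s = 0" using af by (metis (no_types))
  with s f_eq show False by simp
qed

theorem theorem2p5:
  fixes \<phi> :: "(mon \<Rightarrow> 'a::comm_ring_1) \<Rightarrow> (mon \<Rightarrow> 'a)" and n :: nat
  assumes "(0::'a) \<noteq> 1"
    and "reduced_ring TYPE('a)"
    and "n \<ge> 1"
    and "weyl_alg_aut n \<phi>"
  shows "endo_deg n (inv_into (weyl n) \<phi>) \<le> endo_deg n \<phi> ^ (2 * n - 1)"
proof -
  note aut = \<open>weyl_alg_aut n \<phi>\<close>
  let ?\<psi> = "inv_into (weyl n) \<phi>"
  let ?d = "endo_deg n \<phi>"
  let ?X = "\<lambda>c. wmono (gen_mon c) :: mon \<Rightarrow> 'a"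
  let ?N = "generators n"
  have bij: "bij_betw \<phi> (weyl n) (weyl n)" using aut by (simp add: weyl_alg_aut_def)
  have endo_deg: "endo_deg n \<theta> = Max ((\<lambda>c. wdeg n (\<theta> (?X c))) ` ?N)"
    for \<theta> :: "(mon \<Rightarrow> 'a) \<Rightarrow> (mon \<Rightarrow> 'a)"
    by (simp add: endo_deg_def wX_eq_wmono wD_eq_wmono generators_def image_Un image_image)
  have X: "?X c \<in> weyl n" if "c \<in> ?N" for c
    using that by (intro wmono_in_weyl gen_mon_in_wmons)
  have gen: "deg_le n ?d (\<phi> (?X c))" if "c \<in> ?N" for c
  proof (rule deg_le_mono[OF deg_le_wdeg])
    show "\<phi> (?X c) \<in> weyl n" using bij X[OF that] by (auto simp: bij_betw_def)
    show "wdeg n (\<phi> (?X c)) \<le> ?d" unfolding endo_deg using that by (intro Max_ge) (auto simp: generators_def)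
  qed
  have "wdeg n (?\<psi> (?X c)) \<le> ?d ^ (2 * n - 1)" if c: "c \<in> ?N" for c
  proof (rule preimage_degree_bound[OF assms(2,3) aut gen c])
    show inv: "\<phi> (?\<psi> (?X c)) = ?X c" using bij X[OF c] by (rule bij_betw_inv_into_right)
    show "?\<psi> (?X c) \<in> weyl n" using bij X[OF c] by (metis bij_betw_def inv_into_into)
    show "?\<psi> (?X c) \<noteq> (\<lambda>_. 0)"
    proof
      assume "?\<psi> (?X c) = (\<lambda>_. 0)"
      \<comment> \<open>The empty linear combination in \<open>aut_sum\<close> shows that \<phi>
        maps 0 to 0; a generator vanishes only if 1 = 0 in the ring.\<close>
      then have "?X c = (\<lambda>_. 0)" using inv aut_sum(2)[OF aut, of "{}"] by simp
      then have "?X c (gen_mon c) = 0" by simp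
      then show False using assms(1) by (simp add: wmono_def)
    qed
  qed
  moreover have "?N \<noteq> {}" using assms(3) by (auto simp: generators_def lessThan_empty_iff)
  ultimately show ?thesis unfolding endo_deg[of ?\<psi>] by (intro Max.boundedI) (auto simp: generators_def)
qed

end
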